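(* Let $A \in \mathbb{R}^{n \times n}$ be invertible with rows $a_1, \dots, a_n \in \mathbb{R}^n$, let $b \in \mathbb{R}^n$, and let $x \in \mathbb{R}^n$ be the unique solution of $Ax = b$. Let $x_1 \in \mathbb{R}^n$ be arbitrary (deterministic). Let $i_1, i_2, \dots$ be independent random indices in $\{1, \dots, n\}$ with $$\mathbb{P}(i_k = i) = \frac{\|a_i\|^2}{\|A\|_F^2} \qquad (1 \leq i \leq n,\ k \geq 1),$$ and define the random sequence $(x_k)_{k=1}^{\infty}$ by $$x_{k+1} = x_k + 2 \cdot \frac{b_{i_k} - \langle x_k, a_{i_k} \rangle}{\|a_{i_k}\|^2}\, a_{i_k}, \qquad k \geq 1.$$ Then for every integer $m \geq 1$, $$\mathbb{E} \left\| x - \frac{1}{m} \sum_{k=1}^{m} x_k \right\| \leq \frac{1 + \|A\|_F \|A^{-1}\|}{\sqrt{m}} \cdot \|x - x_1\|.$$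
   Context: For vectors, $\|\cdot\|$ is the Euclidean norm and $\langle \cdot, \cdot \rangle$ the standard inner product on $\mathbb{R}^n$. $\|A\|_F$ is the Frobenius norm of $A$, and $\|A^{-1}\|$ is the operator norm (with respect to the Euclidean norm) of the inverse. The map $x_k \mapsto x_{k+1}$ is the reflection of $x_k$ through the hyperplane $\{z \in \mathbb{R}^n : \langle a_{i_k}, z \rangle = b_{i_k}\}$. *)

theory Defs
  imports "HOL-Probability.Probability"
begin

definition frobenius_norm :: "real ^ 'n ^ 'm \<Rightarrow> real" where
  "frobenius_norm A = sqrt (\<Sum>i\<in>UNIV. \<Sum>j\<in>UNIV. (A $ i $ j)\<^sup>2)"

definition matrix_opnorm :: "real ^ 'n ^ 'm \<Rightarrow> real" where
  "matrix_opnorm A = onorm (\<lambda>v. A *v v)"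

end

theory Submission
  imports Defs
begin

text \<open>Write \<open>y\<^sub>k = x - x\<^sub>k\<close>. The true solution lies on every hyperplane, so each step applies to
  \<open>y\<^sub>k\<close> the linear reflection along the chosen row: all the \<open>y\<^sub>k\<close> have the norm of \<open>y\<^sub>1\<close>, and there
  is no convergence without averaging. What makes the average small is decay of correlations.

  With the given probabilities the mean of a random reflection is
  \<open>T = 1 - 2 A\<^sup>T A / \<parallel>A\<parallel>\<^sub>F\<^sup>2\<close>, a self-adjoint map. Averaging over the indices one at a time, the
  last first, shows that \<open>y\<^sub>j \<bullet> y\<^sub>k\<close> for \<open>k = j + l\<close> has the same expectation as \<open>T\<^sup>l y\<^sub>j \<bullet> y\<^sub>j\<close>
  (\<open>expectation_inner_reflect_path\<close>). Put \<open>\<kappa> = \<parallel>A\<parallel>\<^sub>F \<parallel>matrix_inv A\<parallel>\<close>. In dimension at least two, \<open>T\<close>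
  is a contraction with factor \<open>1 - 2 / \<kappa>\<^sup>2\<close> (\<open>norm_mean_reflect_le\<close>), so the correlations of
  \<open>y\<^sub>j\<close> with all later errors form a geometric series and add up to at most \<open>\<kappa>\<^sup>2 / 2\<close> times the
  squared norm; in dimension one \<open>T = -1\<close> and they add up to at most zero
  (\<open>sum_mean_reflect_powers_le\<close>).

  Expanding the square of the sum of \<open>m\<close> errors, the diagonal and twice the correlations give a
  second moment of at most \<open>m (1 + \<kappa>\<^sup>2) \<parallel>y\<^sub>1\<parallel>\<^sup>2\<close>, and \<open>1 + \<kappa>\<^sup>2 \<le> (1 + \<kappa>)\<^sup>2\<close>. The bound on the
  expected norm follows because a variance is nonnegative.\<close>

section \<open>Reflections and their mean\<close>

definition reflect :: "'a::real_inner \<Rightarrow> 'a \<Rightarrow> 'a" where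
  "reflect a v = v - (2 * (a \<bullet> v) / (norm a)\<^sup>2) *\<^sub>R a"

lemma norm_reflect: "norm (reflect a v) = norm v"
proof (cases "a = 0")
  case False
  then have a: "a \<bullet> a \<noteq> 0" by simp
  have "reflect a v \<bullet> reflect a v = v \<bullet> v"
    using a by (simp add: reflect_def inner_diff_left inner_diff_right power2_norm_eq_inner
        inner_commute[of v a])
  then show ?thesis by (simp add: norm_eq_sqrt_inner)
qed (simp add: reflect_def)

text \<open>The expectation of the reflection along a random row, when row \<open>i\<close> is drawn with probability
  \<open>\<parallel>a\<^sub>i\<parallel>\<^sup>2 / \<parallel>A\<parallel>\<^sub>F\<^sup>2\<close>; \<open>inner_mean_reflect_eq_sum\<close> justifies the closed form.\<close>

definition mean_reflect :: "real ^ 'n ^ 'm \<Rightarrow> real ^ 'n \<Rightarrow> real ^ 'n" where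
  "mean_reflect A v = v - (2 / (frobenius_norm A)\<^sup>2) *\<^sub>R (transpose A *v (A *v v))"

lemma norm_vec_square: "(norm v)\<^sup>2 = (\<Sum>i\<in>UNIV. (v $ i)\<^sup>2)"
  for v :: "real ^ 'n"
  by (simp only: power2_norm_eq_inner inner_vec_def) (simp add: power2_eq_square)

lemma frobenius_norm_square:
  fixes A :: "real ^ 'n ^ 'm"
  shows "(frobenius_norm A)\<^sup>2 = (\<Sum>i\<in>UNIV. (norm (row i A))\<^sup>2)"
proof -
  have "(frobenius_norm A)\<^sup>2 = (\<Sum>i\<in>UNIV. \<Sum>j\<in>UNIV. (A $ i $ j)\<^sup>2)"
    unfolding frobenius_norm_def by (intro real_sqrt_pow2 sum_nonneg) auto
  then show ?thesis
    by (simp add: norm_vec_square row_def)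
qed

lemma mult_vec_nth_row: "(A *v v) $ i = row i A \<bullet> v"
  for A :: "real ^ 'n ^ 'm"
  by (simp add: matrix_vector_mul_component row_def vec_lambda_eta)

lemma inner_mean_reflect:
  "w \<bullet> mean_reflect A v = w \<bullet> v - 2 / (frobenius_norm A)\<^sup>2 * ((A *v w) \<bullet> (A *v v))"
proof -
  have "w \<bullet> (transpose A *v (A *v v)) = (A *v w) \<bullet> (A *v v)"
    by (metis dot_lmul_matrix inner_commute transpose_matrix_vector)
  then show ?thesis
    by (simp add: mean_reflect_def inner_diff_right)
qed

lemma mean_reflect_self_adjoint: "mean_reflect A w \<bullet> v = w \<bullet> mean_reflect A v"
  using inner_mean_reflect[of v A w] inner_mean_reflect[of w A v]
  by (simp add: inner_commute)

lemma linear_mean_reflect: "linear (mean_reflect A)"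
  by (rule linearI)
     (simp_all add: mean_reflect_def algebra_simps matrix_vector_right_distrib matrix_vector_mult_scaleR)

text \<open>The weight \<open>\<parallel>a\<^sub>i\<parallel>\<^sup>2 / \<parallel>A\<parallel>\<^sub>F\<^sup>2\<close> cancels the denominator of the reflection along row \<open>i\<close>,
  so the rank-one terms add up to \<open>A\<^sup>T A\<close>: this is the reason for these weights. A zero row is chosen with weight zero, and the convention \<open>x / 0 = 0\<close>
  makes its reflection the identity.\<close>

lemma inner_mean_reflect_eq_sum:
  fixes A :: "real ^ 'n ^ 'm"
  assumes "frobenius_norm A \<noteq> 0"
  shows "w \<bullet> mean_reflect A v =
    (\<Sum>i\<in>UNIV. ((norm (row i A))\<^sup>2 / (frobenius_norm A)\<^sup>2) * (w \<bullet> reflect (row i A) v))"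
proof -
  let ?F = "(frobenius_norm A)\<^sup>2"
  have "(norm (row i A))\<^sup>2 / ?F * (w \<bullet> reflect (row i A) v)
      = (norm (row i A))\<^sup>2 / ?F * (w \<bullet> v) - 2 / ?F * ((A *v w) $ i * (A *v v) $ i)" for i
    by (cases "row i A = 0")
       (simp_all add: reflect_def inner_diff_right mult_vec_nth_row inner_commute[of w] right_diff_distrib)
  then have "(\<Sum>i\<in>UNIV. (norm (row i A))\<^sup>2 / ?F * (w \<bullet> reflect (row i A) v))
      = (\<Sum>i\<in>UNIV. (norm (row i A))\<^sup>2) / ?F * (w \<bullet> v) - 2 / ?F * ((A *v w) \<bullet> (A *v v))"
    by (simp add: sum_subtractf inner_vec_def[of "A *v w"] sum_distrib_left
        flip: sum_distrib_right sum_divide_distrib)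
  then show ?thesis
    using assms by (simp add: inner_mean_reflect flip: frobenius_norm_square)
qed

section \<open>Spectral bounds\<close>

text \<open>Polarization, which replaces the spectral theorem: the bilinear form of \<open>T\<close> at \<open>(w, v)\<close> is a
  difference of two values of its quadratic form, and \<open>w\<close> is taken in the direction of \<open>T v\<close>.\<close>

lemma norm_le_of_quadratic_form_bound:
  fixes T :: "'a::real_inner \<Rightarrow> 'a"
  assumes lin: "linear T" and sym: "\<And>v w. T v \<bullet> w = v \<bullet> T w"
    and q: "\<And>v. \<bar>v \<bullet> T v\<bar> \<le> c * (norm v)\<^sup>2"
  shows "norm (T v) \<le> c * norm v"
proof (cases "T v = 0 \<or> v = 0")
  case True
  have "0 \<le> c * norm v"
  proof (cases "v = 0")
    case False
    have "0 \<le> c * (norm v)\<^sup>2" using q[of v] by linarith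
    then show ?thesis using False by (simp add: zero_le_mult_iff)
  qed simp
  then show ?thesis using True lin by (auto simp: linear_0)
next
  case False
  \<comment> \<open>Scaled to the length of \<open>v\<close>, which makes the estimate from the parallelogram law sharp.\<close>
  define w where "w = (norm v / norm (T v)) *\<^sub>R T v"
  have nw: "norm w = norm v" using False by (simp add: w_def)
  have "4 * (w \<bullet> T v) = (v + w) \<bullet> T (v + w) - (v - w) \<bullet> T (v - w)"
    using sym[of v w]
    by (simp add: linear_add[OF lin] linear_diff[OF lin] inner_add inner_diff algebra_simps inner_commute)
  also have "\<dots> \<le> c * (norm (v + w))\<^sup>2 + c * (norm (v - w))\<^sup>2"
    using q[of "v + w"] q[of "v - w"] by linarith
  also have "\<dots> = 4 * (c * (norm v)\<^sup>2)"
    using nw[THEN arg_cong[where f = "\<lambda>t. t\<^sup>2"]]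
    by (simp add: power2_norm_eq_inner inner_add inner_diff inner_commute[of w v] ring_distribs)
  finally have "w \<bullet> T v \<le> c * (norm v)\<^sup>2" by simp
  moreover have "w \<bullet> T v = norm v * norm (T v)"
    using False by (simp add: w_def power2_eq_square flip: power2_norm_eq_inner)
  ultimately have "norm v * norm (T v) \<le> norm v * (c * norm v)"
    by (simp add: power2_eq_square mult_ac)
  then show ?thesis using False by simp
qed

lemma norm_le_opnorm_inverse:
  fixes A :: "real ^ 'n ^ 'n"
  assumes "invertible A"
  shows "norm v \<le> matrix_opnorm (matrix_inv A) * norm (A *v v)"
proof -
  have "matrix_inv A ** A = mat 1"
    using someI_ex[OF assms[unfolded invertible_def]] by (simp add: matrix_inv_def)
  then have "v = matrix_inv A *v (A *v v)"
    by (simp add: matrix_vector_mul_assoc)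
  then show ?thesis
    unfolding matrix_opnorm_def by (metis onorm matrix_vector_mul_bounded_linear)
qed

lemma frobenius_norm_nonzero:
  fixes A :: "real ^ 'n ^ 'n"
  assumes "invertible A"
  shows "frobenius_norm A \<noteq> 0"
proof
  assume "frobenius_norm A = 0"
  then have "(\<Sum>i\<in>UNIV. (norm (row i A))\<^sup>2) = 0"
    by (simp flip: frobenius_norm_square)
  then have rows: "row i A = 0" for i
    by (simp add: sum_nonneg_eq_0_iff)
  have A: "A *v axis undefined 1 = 0"
    by (simp add: vec_eq_iff[of "A *v _"] mult_vec_nth_row rows)
  have "norm (axis undefined 1 :: real ^ 'n) \<le> 0"
    using norm_le_opnorm_inverse[OF assms, of "axis undefined 1"] unfolding A by simp
  then show False by simp
qed

lemma bessel_two: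
  fixes a u v :: "'a::real_inner"
  assumes "norm u = 1" "norm v = 1" "u \<bullet> v = 0"
  shows "(a \<bullet> u)\<^sup>2 + (a \<bullet> v)\<^sup>2 \<le> (norm a)\<^sup>2"
proof -
  have uv: "u \<bullet> u = 1" "v \<bullet> v = 1" "v \<bullet> u = 0"
    using assms by (simp_all add: norm_eq_1 inner_commute)
  let ?r = "a - (a \<bullet> u) *\<^sub>R u - (a \<bullet> v) *\<^sub>R v"
  have "0 \<le> ?r \<bullet> ?r" by simp
  also have "?r \<bullet> ?r = (norm a)\<^sup>2 - (a \<bullet> u)\<^sup>2 - (a \<bullet> v)\<^sup>2"
    using uv assms(3)
    by (simp add: inner_diff power2_norm_eq_inner power2_eq_square[of "_ \<bullet> _"]
        inner_commute[of u a] inner_commute[of v a])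
  finally show ?thesis by simp
qed

text \<open>In terms of singular values, \<open>\<sigma>\<^sub>1\<^sup>2 + \<sigma>\<^sub>2\<^sup>2 \<le> \<parallel>A\<parallel>\<^sub>F\<^sup>2\<close>; it follows from Bessel's inequality
  for each row.\<close>

lemma norm_mult_vec_orthonormal_le:
  fixes A :: "real ^ 'n ^ 'm"
  assumes "norm u = 1" "norm v = 1" "u \<bullet> v = 0"
  shows "(norm (A *v u))\<^sup>2 + (norm (A *v v))\<^sup>2 \<le> (frobenius_norm A)\<^sup>2"
proof -
  have "(norm (A *v u))\<^sup>2 + (norm (A *v v))\<^sup>2
      = (\<Sum>i\<in>UNIV. (row i A \<bullet> u)\<^sup>2 + (row i A \<bullet> v)\<^sup>2)"
    by (simp add: norm_vec_square mult_vec_nth_row sum.distrib)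
  also have "\<dots> \<le> (frobenius_norm A)\<^sup>2"
    unfolding frobenius_norm_square by (intro sum_mono bessel_two assms)
  finally show ?thesis .
qed

text \<open>The upper bound on the quadratic form is the lower bound on \<open>\<parallel>A v\<parallel>\<close>. The eigenvalues of the
  mean also have to stay away from \<open>-1\<close>, that is, \<open>\<parallel>A v\<parallel>\<close> has to stay below \<open>\<parallel>A\<parallel>\<^sub>F \<parallel>v\<parallel>\<close>. This
  is where a second dimension enters: a vector orthogonal to \<open>v\<close> uses up at least
  \<open>1 / \<parallel>matrix_inv A\<parallel>\<^sup>2\<close> of the squared Frobenius norm.\<close>

lemma norm_mean_reflect_le:
  fixes A :: "real ^ 'n ^ 'n"
  assumes inv: "invertible A" and card: "CARD('n) \<ge> 2"
    and \<kappa>: "\<kappa> = frobenius_norm A * matrix_opnorm (matrix_inv A)"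
  shows "2 \<le> \<kappa>\<^sup>2" and "norm (mean_reflect A v) \<le> (1 - 2 / \<kappa>\<^sup>2) * norm v"
proof -
  let ?N = "matrix_opnorm (matrix_inv A)" and ?F = "frobenius_norm A"
  have lower: "(norm v)\<^sup>2 \<le> ?N\<^sup>2 * (norm (A *v v))\<^sup>2" for v
    using power_mono[OF norm_le_opnorm_inverse[OF inv, of v], of 2] by (simp add: power_mult_distrib)
  have upper: "(norm v)\<^sup>2 \<le> ?N\<^sup>2 * (?F\<^sup>2 * (norm v)\<^sup>2 - (norm (A *v v))\<^sup>2)" for v
  proof (cases "v = 0")
    case False
    obtain y :: "real ^ 'n" where y: "y \<noteq> 0" "orthogonal v y"
      using orthogonal_to_vector_exists[of v] card by auto
    define u where "u = (1 / norm y) *\<^sub>R y"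
    define w where "w = (1 / norm v) *\<^sub>R v"
    have v: "v = norm v *\<^sub>R w" using False by (simp add: w_def)
    have uw: "norm u = 1" "norm w = 1" "u \<bullet> w = 0"
      using y False by (simp_all add: u_def w_def orthogonal_def inner_commute)
    have "1 \<le> ?N\<^sup>2 * (norm (A *v u))\<^sup>2" using lower[of u] uw by simp
    also have "\<dots> \<le> ?N\<^sup>2 * (?F\<^sup>2 - (norm (A *v w))\<^sup>2)"
      using norm_mult_vec_orthonormal_le[OF uw, of A] by (intro mult_left_mono) auto
    finally have "(norm v)\<^sup>2 * 1 \<le> (norm v)\<^sup>2 * (?N\<^sup>2 * (?F\<^sup>2 - (norm (A *v w))\<^sup>2))"
      by (intro mult_left_mono) auto
    moreover have "(norm (A *v v))\<^sup>2 = (norm v)\<^sup>2 * (norm (A *v w))\<^sup>2"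
      by (subst v) (simp add: matrix_vector_mult_scaleR power_mult_distrib uw)
    ultimately show ?thesis by (simp add: algebra_simps)
  qed simp
  have \<kappa>2: "\<kappa>\<^sup>2 = ?N\<^sup>2 * ?F\<^sup>2" by (simp add: \<kappa> power_mult_distrib)
  have "2 \<le> \<kappa>\<^sup>2"
    using lower[of "axis undefined 1"] upper[of "axis undefined 1"] by (simp add: \<kappa>2 algebra_simps)
  then have F: "?F\<^sup>2 > 0" and pos: "\<kappa>\<^sup>2 > 0" by (auto simp: \<kappa>)
  have "\<bar>v \<bullet> mean_reflect A v\<bar> \<le> (1 - 2 / \<kappa>\<^sup>2) * (norm v)\<^sup>2" for v
  proof -
    have q: "\<kappa>\<^sup>2 * (v \<bullet> mean_reflect A v)
        = \<kappa>\<^sup>2 * (norm v)\<^sup>2 - 2 * (?N\<^sup>2 * (norm (A *v v))\<^sup>2)"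
      using F by (simp add: inner_mean_reflect \<kappa>2 power2_norm_eq_inner field_simps)
    have "\<kappa>\<^sup>2 * \<bar>v \<bullet> mean_reflect A v\<bar> = \<bar>\<kappa>\<^sup>2 * (v \<bullet> mean_reflect A v)\<bar>"
      by (simp add: abs_mult)
    also have "\<dots> \<le> \<kappa>\<^sup>2 * (norm v)\<^sup>2 - 2 * (norm v)\<^sup>2"
      unfolding q using lower[of v] upper[of v] by (simp add: \<kappa>2 algebra_simps abs_le_iff)
    also have "\<dots> = \<kappa>\<^sup>2 * ((1 - 2 / \<kappa>\<^sup>2) * (norm v)\<^sup>2)"
      using pos by (simp add: field_simps)
    finally show ?thesis using pos by (simp only: mult_le_cancel_left_pos)
  qed
  then show "norm (mean_reflect A v) \<le> (1 - 2 / \<kappa>\<^sup>2) * norm v"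
    by (intro norm_le_of_quadratic_form_bound linear_mean_reflect mean_reflect_self_adjoint)
  show "2 \<le> \<kappa>\<^sup>2" by fact
qed

lemma mean_reflect_one_dim:
  fixes A :: "real ^ 'n ^ 'n"
  assumes inv: "invertible A" and card: "CARD('n) = 1"
  shows "mean_reflect A v = - v"
proof -
  obtain k :: 'n where k: "UNIV = {k}" using card by (auto simp: card_1_singleton_iff)
  have all: "i = k" for i :: 'n using k by auto
  have "A $ k $ k \<noteq> 0"
  proof
    assume "A $ k $ k = 0"
    then have "A $ i $ k = 0" for i using all[of i] by simp
    then have "A *v axis k 1 = A *v 0" by (simp add: vec_eq_iff matrix_vector_mult_def k)
    moreover have "inj ((*v) A)" using inv by (simp add: inj_matrix_vector_mult)
    ultimately show False by (metis axis_eq_0_iff injD zero_neq_one)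
  qed
  then have "mean_reflect A v $ k = - (v $ k)"
    by (simp add: mean_reflect_def frobenius_norm_def matrix_vector_mult_def transpose_def k
        power2_eq_square)
  then have "mean_reflect A v $ i = (- v) $ i" for i
    by (simp add: all[of i])
  then show ?thesis unfolding vec_eq_iff by blast
qed

text \<open>For dimension at least two this is a geometric series with ratio \<open>1 - 2 / \<kappa>\<^sup>2\<close>. In dimension one
  the mean is \<open>-1\<close>, no contraction at all, but then the terms alternate in sign and the sum is
  never positive.\<close>

lemma sum_mean_reflect_powers_le:
  fixes A :: "real ^ 'n ^ 'n"
  assumes inv: "invertible A"
    and \<kappa>: "\<kappa> = frobenius_norm A * matrix_opnorm (matrix_inv A)"
  shows "(\<Sum>l=1..L. (mean_reflect A ^^ l) v \<bullet> v) \<le> \<kappa>\<^sup>2 / 2 * (norm v)\<^sup>2"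
proof (cases "CARD('n) \<ge> 2")
  case True
  define c where "c = 1 - 2 / \<kappa>\<^sup>2"
  have \<kappa>2: "2 \<le> \<kappa>\<^sup>2" using norm_mean_reflect_le(1)[OF inv True \<kappa>] .
  have "0 < \<kappa>\<^sup>2" using \<kappa>2 by linarith
  then have c: "0 \<le> c" "c < 1" "1 / (1 - c) = \<kappa>\<^sup>2 / 2"
    using \<kappa>2 by (simp_all add: c_def divide_le_eq_1_pos)
  have pow: "norm ((mean_reflect A ^^ l) v) \<le> c ^ l * norm v" for l
  proof (induction l)
    case (Suc l)
    have "norm ((mean_reflect A ^^ Suc l) v) \<le> c * norm ((mean_reflect A ^^ l) v)"
      using norm_mean_reflect_le(2)[OF inv True \<kappa>] by (simp add: c_def)
    also have "\<dots> \<le> c * (c ^ l * norm v)" using Suc c by (intro mult_left_mono) auto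
    finally show ?case by (simp add: mult_ac)
  qed simp
  have "(\<Sum>l=1..L. (mean_reflect A ^^ l) v \<bullet> v) \<le> (\<Sum>l=1..L. c ^ l * (norm v)\<^sup>2)"
  proof (rule sum_mono)
    fix l
    have "(mean_reflect A ^^ l) v \<bullet> v \<le> norm ((mean_reflect A ^^ l) v) * norm v"
      by (rule norm_cauchy_schwarz)
    also have "\<dots> \<le> c ^ l * norm v * norm v" by (intro mult_right_mono pow) auto
    finally show "(mean_reflect A ^^ l) v \<bullet> v \<le> c ^ l * (norm v)\<^sup>2"
      by (simp add: power2_eq_square mult_ac)
  qed
  also have "\<dots> = (\<Sum>l=1..L. c ^ l) * (norm v)\<^sup>2" by (simp add: sum_distrib_right)
  also have "\<dots> \<le> (\<Sum>l. c ^ l) * (norm v)\<^sup>2"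
    using c by (intro mult_right_mono sum_le_suminf summable_geometric) auto
  also have "(\<Sum>l. c ^ l) = \<kappa>\<^sup>2 / 2"
    using suminf_geometric[of c] c by simp
  finally show ?thesis .
next
  case False
  then have one: "CARD('n) = 1"
    by (metis One_nat_def Suc_1 Suc_leI finite_UNIV_card_ge_0 finite le_neq_implies_less)
  have pow: "(mean_reflect A ^^ l) v = (-1) ^ l *\<^sub>R v" for l
    by (induction l) (simp_all add: mean_reflect_one_dim[OF inv one])
  have "(\<Sum>l=1..L. (-1::real) ^ l) = (if even L then 0 else -1)"
    by (induction L) auto
  then have "(\<Sum>l=1..L. (mean_reflect A ^^ l) v \<bullet> v) \<le> 0"
    by (simp add: pow flip: sum_distrib_right)
  also have "0 \<le> \<kappa>\<^sup>2 / 2 * (norm v)\<^sup>2" by simp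
  finally show ?thesis .
qed

section \<open>Random reflections\<close>

text \<open>The vector at time \<open>0\<close> is the initial one, and the step to time \<open>n\<close> uses the index \<open>f n\<close>, so
  the path at time \<open>n\<close> is the error of the iterate with number \<open>n + 1\<close>.\<close>

primrec reflect_path :: "('i \<Rightarrow> 'a::real_inner) \<Rightarrow> 'a \<Rightarrow> (nat \<Rightarrow> 'i) \<Rightarrow> nat \<Rightarrow> 'a" where
  "reflect_path a v f 0 = v"
| "reflect_path a v f (Suc n) = reflect (a (f (Suc n))) (reflect_path a v f n)"

lemma norm_reflect_path: "norm (reflect_path a v f n) = norm v"
  by (induction n) (simp_all add: norm_reflect)

lemma reflect_path_cong:
  "(\<And>k. k \<in> {1..n} \<Longrightarrow> f k = g k) \<Longrightarrow> reflect_path a v f n = reflect_path a v g n"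
  by (induction n) auto

text \<open>The path up to time \<open>n\<close> as a function of the finite past only; independence of the next
  index is applied to this form.\<close>

lemma reflect_path_restrict:
  "n \<le> N \<Longrightarrow> reflect_path a v (restrict f {1..N}) n = reflect_path a v f n"
  by (rule reflect_path_cong) auto

lemma borel_measurable_reflect [measurable]:
  fixes a :: "'a::euclidean_space"
  assumes [measurable]: "Y \<in> borel_measurable N"
  shows "(\<lambda>x. reflect a (Y x)) \<in> borel_measurable N"
  unfolding reflect_def by measurable

lemma borel_measurable_reflect_path:
  fixes a :: "'i::finite \<Rightarrow> 'a::euclidean_space"
  assumes "\<And>k. k \<in> {1..n} \<Longrightarrow> (\<lambda>x. f x k) \<in> measurable N (count_space UNIV)"
  shows "(\<lambda>x. reflect_path a v (f x) n) \<in> borel_measurable N"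
  using assms
proof (induction n)
  case (Suc n)
  have [measurable]: "(\<lambda>x. reflect_path a v (f x) n) \<in> borel_measurable N"
    using Suc by auto
  have "(\<lambda>x. reflect (a (f x (Suc n))) (reflect_path a v (f x) n)) \<in> borel_measurable N"
    by (rule measurable_compose_countable'[where I = UNIV and g = "\<lambda>x. f x (Suc n)"
          and f = "\<lambda>i x. reflect (a i) (reflect_path a v (f x) n)"])
       (use Suc.prems in \<open>auto simp: uncountable_infinite\<close>)
  then show ?case by simp
qed simp

text \<open>Conditioning on the past: since the next index takes finitely many values, averaging over it
  needs only the product rule for expectations of independent variables, applied to
  \<open>h i\<close> of the past and the indicator of the value \<open>i\<close>.\<close>

lemma (in prob_space) expectation_next_index:
  fixes I :: "nat \<Rightarrow> 'a \<Rightarrow> 'i::finite" and h :: "'i \<Rightarrow> (nat \<Rightarrow> 'i) \<Rightarrow> real"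
  assumes indep: "indep_vars (\<lambda>_. count_space UNIV) I {1..}"
    and p: "\<And>i. prob {\<omega> \<in> space M. I (Suc n) \<omega> = i} = p i"
    and h[measurable]: "\<And>i. h i \<in> borel_measurable (PiM {1..n} (\<lambda>_. count_space UNIV))"
    and bound: "\<And>i f. \<bar>h i f\<bar> \<le> B"
  shows "expectation (\<lambda>\<omega>. h (I (Suc n) \<omega>) (restrict (\<lambda>k. I k \<omega>) {1..n}))
    = expectation (\<lambda>\<omega>. \<Sum>i\<in>UNIV. p i * h i (restrict (\<lambda>k. I k \<omega>) {1..n}))"
proof -
  define r where "r \<omega> = restrict (\<lambda>k. I k \<omega>) {1..n}" for \<omega>
  define e :: "'i \<Rightarrow> 'a \<Rightarrow> real" where "e i \<omega> = of_bool (I (Suc n) \<omega> = i)" for i \<omega>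
  have I: "I k \<in> measurable M (count_space UNIV)" if "k \<ge> 1" for k
    using indep that by (auto simp: indep_vars_def)
  have r[measurable]: "r \<in> measurable M (PiM {1..n} (\<lambda>_. count_space UNIV))"
    unfolding r_def by (intro measurable_restrict I) auto
  have [measurable]: "I (Suc n) \<in> measurable M (count_space UNIV)" by (rule I) simp
  have e[measurable]: "e i \<in> borel_measurable M" for i unfolding e_def by measurable
  have int: "integrable M (\<lambda>\<omega>. h i (r \<omega>))" for i
    by (rule integrable_const_bound[of _ B]) (use bound in auto)
  have int_e: "integrable M (e i)" for i
    by (rule integrable_const_bound[of _ 1]) (auto simp: e_def)
  have Ee: "expectation (e i) = p i" for i
  proof -
    have "e i = indicator {\<omega>. I (Suc n) \<omega> = i}" by (auto simp: e_def fun_eq_iff indicator_def)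
    then have "expectation (e i) = prob ({\<omega>. I (Suc n) \<omega> = i} \<inter> space M)"
      by simp
    also have "{\<omega>. I (Suc n) \<omega> = i} \<inter> space M = {\<omega> \<in> space M. I (Suc n) \<omega> = i}" by auto
    finally show ?thesis by (simp add: p)
  qed
  have ind: "indep_var borel (\<lambda>\<omega>. h i (r \<omega>)) borel (e i)" for i
  proof -
    have "indep_var (PiM {1..n} (\<lambda>_. count_space UNIV)) r
        (PiM {Suc n} (\<lambda>_. count_space UNIV)) (\<lambda>\<omega>. restrict (\<lambda>k. I k \<omega>) {Suc n})"
      unfolding r_def by (rule indep_var_restrict[OF indep]) auto
    then have "indep_var borel (h i \<circ> r) borel
        ((\<lambda>f. of_bool (f (Suc n) = i)) \<circ> (\<lambda>\<omega>. restrict (\<lambda>k. I k \<omega>) {Suc n}))"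
      by (rule indep_var_compose) measurable
    then show ?thesis by (simp add: comp_def e_def[abs_def])
  qed
  have prod: "integrable M (\<lambda>\<omega>. h i (r \<omega>) * e i \<omega>)"
    "expectation (\<lambda>\<omega>. h i (r \<omega>) * e i \<omega>) = expectation (\<lambda>\<omega>. h i (r \<omega>)) * p i" for i
    using indep_var_integrable[OF ind int int_e] indep_var_lebesgue_integral[OF ind int int_e]
    by (simp_all add: Ee)
  have "h (I (Suc n) \<omega>) (r \<omega>) = (\<Sum>i\<in>UNIV. h i (r \<omega>) * e i \<omega>)" for \<omega>
    by (simp add: e_def of_bool_def if_distrib cong: if_cong)
  then have "expectation (\<lambda>\<omega>. h (I (Suc n) \<omega>) (r \<omega>)) = (\<Sum>i\<in>UNIV. expectation (\<lambda>\<omega>. h i (r \<omega>) * e i \<omega>))"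
    by (simp add: prod)
  also have "\<dots> = expectation (\<lambda>\<omega>. \<Sum>i\<in>UNIV. p i * h i (r \<omega>))"
    by (simp add: prod(2) int) (simp add: mult.commute)
  finally show ?thesis by (simp add: r_def)
qed

lemma bounded_linear_mean_reflect_power: "bounded_linear (mean_reflect A ^^ q)"
proof -
  have "linear (mean_reflect A ^^ q)"
  proof (induction q)
    case (Suc q)
    then show ?case using linear_compose[OF Suc linear_mean_reflect] by (simp add: comp_def)
  qed (simp add: linear_id[unfolded id_def] id_def)
  then show ?thesis by (rule linear_linear[THEN iffD2])
qed

text \<open>Averaging over the last index replaces the last reflection by its mean, which is self-adjoint
  and therefore moves to the other factor. The exponent \<open>q\<close> makes room for this in the induction
  on \<open>l\<close>; the case of interest is \<open>q = 0\<close>.\<close>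

lemma (in prob_space) expectation_inner_reflect_path:
  fixes A :: "real ^ 'n ^ 'm" and I :: "nat \<Rightarrow> 'a \<Rightarrow> 'm" and v :: "real ^ 'n"
  defines "Y \<equiv> \<lambda>n \<omega>. reflect_path (\<lambda>i. row i A) v (\<lambda>k. I k \<omega>) n"
  assumes indep: "indep_vars (\<lambda>_. count_space UNIV) I {1..}"
    and p: "\<And>k i. k \<ge> 1 \<Longrightarrow>
      prob {\<omega> \<in> space M. I k \<omega> = i} = (norm (row i A))\<^sup>2 / (frobenius_norm A)\<^sup>2"
    and F: "frobenius_norm A \<noteq> 0"
  shows "expectation (\<lambda>\<omega>. (mean_reflect A ^^ q) (Y j \<omega>) \<bullet> Y (j + l) \<omega>)
    = expectation (\<lambda>\<omega>. (mean_reflect A ^^ (q + l)) (Y j \<omega>) \<bullet> Y j \<omega>)"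
proof (induction l arbitrary: q)
  case (Suc l)
  define n where "n = j + l"
  let ?path = "reflect_path (\<lambda>i. row i A) v"
  let ?T = "mean_reflect A ^^ q"
  define h where "h i f = ?T (?path f j) \<bullet> reflect (row i A) (?path f n)" for i f
  let ?r = "\<lambda>\<omega>. restrict (\<lambda>k. I k \<omega>) {1..n}"
  have bl: "bounded_linear ?T" by (rule bounded_linear_mean_reflect_power)
  have path: "(\<lambda>f. ?path f k) \<in> borel_measurable (PiM {1..n} (\<lambda>_. count_space UNIV))" if "k \<le> n" for k
    by (rule borel_measurable_reflect_path) (use that in auto)
  have T: "?T \<in> borel_measurable borel"
    using bl by (intro borel_measurable_continuous_onI linear_continuous_on)
  have h: "h i \<in> borel_measurable (PiM {1..n} (\<lambda>_. count_space UNIV))" for i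
    unfolding h_def
    by (intro borel_measurable_inner borel_measurable_reflect path measurable_compose[OF path T])
       (auto simp: n_def)
  obtain K where K: "\<And>u. norm (?T u) \<le> norm u * K" using bl bounded_linear.bounded by blast
  have bound: "\<bar>h i f\<bar> \<le> norm v * K * norm v" for i f
  proof -
    have "\<bar>h i f\<bar> \<le> norm (?T (?path f j)) * norm (reflect (row i A) (?path f n))"
      unfolding h_def by (rule Cauchy_Schwarz_ineq2)
    also have "\<dots> \<le> norm v * K * norm v"
      using K[of "?path f j"] by (auto simp: norm_reflect norm_reflect_path intro: mult_right_mono)
    finally show ?thesis .
  qed
  have "expectation (\<lambda>\<omega>. ?T (Y j \<omega>) \<bullet> Y (j + Suc l) \<omega>) = expectation (\<lambda>\<omega>. h (I (Suc n) \<omega>) (?r \<omega>))"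
    unfolding h_def Y_def by (simp add: n_def reflect_path_restrict[unfolded One_nat_def] del: restrict_apply)
  also have "\<dots> = expectation (\<lambda>\<omega>. \<Sum>i\<in>UNIV.
      ((norm (row i A))\<^sup>2 / (frobenius_norm A)\<^sup>2) * h i (?r \<omega>))"
    by (rule expectation_next_index[OF indep p h bound]) simp
  also have "\<dots> = expectation (\<lambda>\<omega>. ?T (Y j \<omega>) \<bullet> mean_reflect A (Y n \<omega>))"
    unfolding inner_mean_reflect_eq_sum[OF F] h_def Y_def
    by (simp add: n_def reflect_path_restrict[unfolded One_nat_def] del: restrict_apply)
  also have "\<dots> = expectation (\<lambda>\<omega>. (mean_reflect A ^^ Suc q) (Y j \<omega>) \<bullet> Y (j + l) \<omega>)"
    by (simp add: mean_reflect_self_adjoint n_def)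
  also have "\<dots> = expectation (\<lambda>\<omega>. (mean_reflect A ^^ (q + Suc l)) (Y j \<omega>) \<bullet> Y j \<omega>)"
    by (subst Suc.IH) simp
  finally show ?case .
qed simp

section \<open>The averaged iterates\<close>

lemma sum_symmetric_square:
  fixes f :: "nat \<Rightarrow> nat \<Rightarrow> 'a::comm_semiring_1"
  assumes "\<And>i j. f i j = f j i"
  shows "(\<Sum>i<m. \<Sum>j<m. f i j) = (\<Sum>i<m. f i i) + 2 * (\<Sum>i<m. \<Sum>l=1..<m - i. f i (i + l))"
proof (induction m)
  case (Suc m)
  have "(\<Sum>i<Suc m. \<Sum>l=1..<Suc m - i. f i (i + l)) = (\<Sum>i<m. \<Sum>l=1..<Suc (m - i). f i (i + l))"
    by (simp add: Suc_diff_le)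
  also have "\<dots> = (\<Sum>i<m. (\<Sum>l=1..<m - i. f i (i + l)) + f i m)"
    by (intro sum.cong refl) simp
  finally have "(\<Sum>i<Suc m. \<Sum>l=1..<Suc m - i. f i (i + l))
      = (\<Sum>i<m. \<Sum>l=1..<m - i. f i (i + l)) + (\<Sum>i<m. f i m)"
    by (simp add: sum.distrib)
  moreover have "(\<Sum>i<m. f m i) = (\<Sum>i<m. f i m)" using assms by simp
  ultimately show ?case
    by (simp add: Suc.IH sum.distrib algebra_simps mult_2)
qed simp

text \<open>In the second moment the diagonal contributes \<open>m \<parallel>v\<parallel>\<^sup>2\<close> and the correlations of a fixed \<open>Y i\<close>
  with all later vectors contribute at most \<open>\<kappa>\<^sup>2 / 2 \<parallel>v\<parallel>\<^sup>2\<close>, whatever the position of \<open>Y i\<close>.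
  This gives the factor \<open>1 + \<kappa>\<^sup>2\<close>, at most \<open>(1 + \<kappa>)\<^sup>2\<close>.\<close>

lemma (in prob_space) expectation_norm_sum_reflect_path_le:
  fixes A :: "real ^ 'n ^ 'n" and I :: "nat \<Rightarrow> 'a \<Rightarrow> 'n" and v :: "real ^ 'n"
  defines "Y \<equiv> \<lambda>n \<omega>. reflect_path (\<lambda>i. row i A) v (\<lambda>k. I k \<omega>) n"
  assumes inv: "invertible A"
    and indep: "indep_vars (\<lambda>_. count_space UNIV) I {1..}"
    and p: "\<And>k i. k \<ge> 1 \<Longrightarrow>
      prob {\<omega> \<in> space M. I k \<omega> = i} = (norm (row i A))\<^sup>2 / (frobenius_norm A)\<^sup>2"
    and \<kappa>: "\<kappa> = frobenius_norm A * matrix_opnorm (matrix_inv A)"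
  shows "expectation (\<lambda>\<omega>. norm (\<Sum>n<m. Y n \<omega>)) \<le> (1 + \<kappa>) * sqrt m * norm v"
proof -
  have F: "frobenius_norm A \<noteq> 0"
    by (rule frobenius_norm_nonzero[OF inv])
  have \<kappa>0: "0 \<le> \<kappa>"
  proof -
    have "0 \<le> frobenius_norm A" by (simp add: frobenius_norm_def sum_nonneg)
    moreover have "0 \<le> matrix_opnorm (matrix_inv A)"
      unfolding matrix_opnorm_def by (rule onorm_pos_le[OF matrix_vector_mul_bounded_linear])
    ultimately show ?thesis by (simp add: \<kappa>)
  qed
  have I: "I k \<in> measurable M (count_space UNIV)" if "k \<ge> 1" for k
    using indep that by (auto simp: indep_vars_def)
  have Y[measurable]: "Y n \<in> borel_measurable M" for n
    unfolding Y_def by (rule borel_measurable_reflect_path) (use I in auto)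
  have nY: "norm (Y n \<omega>) = norm v" for n \<omega> by (simp add: Y_def norm_reflect_path)
  have int: "integrable M (\<lambda>\<omega>. Y i \<omega> \<bullet> Y j \<omega>)" for i j
    by (rule integrable_const_bound[of _ "norm v * norm v"])
       (use Cauchy_Schwarz_ineq2[where x = "Y i \<omega>" and y = "Y j \<omega>" for \<omega>] in
         \<open>auto simp only: nY real_norm_def\<close>, measurable)
  define S where "S \<omega> = (\<Sum>n<m. Y n \<omega>)" for \<omega>
  have S_sq: "(norm (S \<omega>))\<^sup>2 = (\<Sum>i<m. \<Sum>j<m. Y i \<omega> \<bullet> Y j \<omega>)" for \<omega>
    unfolding S_def power2_norm_eq_inner inner_sum_left inner_sum_right by (rule sum.swap)
  have [measurable]: "S \<in> borel_measurable M" unfolding S_def by measurable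
  have int_sq: "integrable M (\<lambda>\<omega>. (norm (S \<omega>))\<^sup>2)" by (simp add: S_sq int)
  have int_S: "integrable M (\<lambda>\<omega>. norm (S \<omega>))"
  proof (rule integrable_const_bound[of _ "m * norm v"])
    show "AE \<omega> in M. norm (norm (S \<omega>)) \<le> m * norm v"
      using sum_norm_le[of "{..<m}" "\<lambda>n. Y n _" "\<lambda>_. norm v"] by (auto simp: S_def nY)
  qed measurable
  have int_T: "integrable M (\<lambda>\<omega>. (mean_reflect A ^^ l) (Y i \<omega>) \<bullet> Y i \<omega>)" for l i
  proof -
    have bl: "bounded_linear (mean_reflect A ^^ l)" by (rule bounded_linear_mean_reflect_power)
    then have [measurable]: "(mean_reflect A ^^ l) \<in> borel_measurable borel"
      by (intro borel_measurable_continuous_onI linear_continuous_on)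
    obtain K where K: "\<And>u. norm ((mean_reflect A ^^ l) u) \<le> norm u * K"
      using bl bounded_linear.bounded by blast
    have "\<bar>(mean_reflect A ^^ l) (Y i \<omega>) \<bullet> Y i \<omega>\<bar> \<le> norm v * K * norm v" for \<omega>
      using Cauchy_Schwarz_ineq2[of "(mean_reflect A ^^ l) (Y i \<omega>)" "Y i \<omega>"]
        mult_right_mono[OF K[of "Y i \<omega>"], of "norm v"]
      by (simp add: nY)
    then show ?thesis
      by (intro integrable_const_bound[of _ "norm v * K * norm v"]) auto
  qed
  have cross: "(\<Sum>l=1..<m - i. expectation (\<lambda>\<omega>. Y i \<omega> \<bullet> Y (i + l) \<omega>)) \<le> \<kappa>\<^sup>2 / 2 * (norm v)\<^sup>2" for i
  proof -
    have "(\<Sum>l=1..<m - i. expectation (\<lambda>\<omega>. Y i \<omega> \<bullet> Y (i + l) \<omega>))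
        = (\<Sum>l=1..<m - i. expectation (\<lambda>\<omega>. (mean_reflect A ^^ l) (Y i \<omega>) \<bullet> Y i \<omega>))"
      using expectation_inner_reflect_path[OF indep p F, where q = 0] by (simp add: Y_def)
    also have "\<dots> = expectation (\<lambda>\<omega>. \<Sum>l=1..m - i - 1. (mean_reflect A ^^ l) (Y i \<omega>) \<bullet> Y i \<omega>)"
      by (subst Bochner_Integration.integral_sum) (auto intro!: int_T sum.cong)
    also have "\<dots> \<le> \<kappa>\<^sup>2 / 2 * (norm v)\<^sup>2"
      using sum_mean_reflect_powers_le[OF inv \<kappa>, of "Y i _" "m - i - 1"]
      by (intro integral_le_const Bochner_Integration.integrable_sum int_T AE_I2) (simp add: nY)
    finally show ?thesis .
  qed
  have "expectation (\<lambda>\<omega>. (norm (S \<omega>))\<^sup>2) = (\<Sum>i<m. \<Sum>j<m. expectation (\<lambda>\<omega>. Y i \<omega> \<bullet> Y j \<omega>))"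
    by (simp add: S_sq int)
  also have "\<dots> = (\<Sum>i<m. expectation (\<lambda>\<omega>. Y i \<omega> \<bullet> Y i \<omega>))
      + 2 * (\<Sum>i<m. \<Sum>l=1..<m - i. expectation (\<lambda>\<omega>. Y i \<omega> \<bullet> Y (i + l) \<omega>))"
    by (rule sum_symmetric_square) (simp add: inner_commute)
  also have "\<dots> \<le> (\<Sum>i<m. (norm v)\<^sup>2) + 2 * (\<Sum>i<m. \<kappa>\<^sup>2 / 2 * (norm v)\<^sup>2)"
    using cross by (intro add_mono mult_left_mono sum_mono)
      (auto simp: nY prob_space simp flip: power2_norm_eq_inner)
  also have "\<dots> = (1 + \<kappa>\<^sup>2) * m * (norm v)\<^sup>2" by (simp add: algebra_simps)
  also have "\<dots> \<le> (1 + \<kappa>)\<^sup>2 * m * (norm v)\<^sup>2"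
    using \<kappa>0 by (intro mult_right_mono) (auto simp: power2_sum)
  also have "\<dots> = ((1 + \<kappa>) * sqrt m * norm v)\<^sup>2" by (simp add: power_mult_distrib)
  finally have "expectation (\<lambda>\<omega>. (norm (S \<omega>))\<^sup>2) \<le> ((1 + \<kappa>) * sqrt m * norm v)\<^sup>2" .
  moreover have "(expectation (\<lambda>\<omega>. norm (S \<omega>)))\<^sup>2 \<le> expectation (\<lambda>\<omega>. (norm (S \<omega>))\<^sup>2)"
    using variance_eq[OF int_S int_sq] variance_positive[of "\<lambda>\<omega>. norm (S \<omega>)"] by linarith
  ultimately have "(expectation (\<lambda>\<omega>. norm (S \<omega>)))\<^sup>2 \<le> ((1 + \<kappa>) * sqrt m * norm v)\<^sup>2" by linarith
  then show ?thesis
    unfolding S_def by (rule power2_le_imp_le) (use \<kappa>0 in simp)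
qed

theorem mainTheorem1:
  fixes A :: "real ^ 'n ^ 'n"
    and b x x1 :: "real ^ 'n"
    and M :: "'w measure"
    and I :: "nat \<Rightarrow> 'w \<Rightarrow> 'n"
    and X :: "nat \<Rightarrow> 'w \<Rightarrow> real ^ 'n"
    and m :: nat
  assumes "invertible A"
    and "A *v x = b"
    and "prob_space M"
    and "prob_space.indep_vars M (\<lambda>_. count_space UNIV) I {1..}"
    and "\<And>k i. k \<ge> 1 \<Longrightarrow>
      measure M {\<omega> \<in> space M. I k \<omega> = i} = (norm (row i A))\<^sup>2 / (frobenius_norm A)\<^sup>2"
    and "\<And>\<omega>. \<omega> \<in> space M \<Longrightarrow> X 1 \<omega> = x1"
    and "\<And>k \<omega>. k \<ge> 1 \<Longrightarrow> \<omega> \<in> space M \<Longrightarrow>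
      X (Suc k) \<omega> = X k \<omega> +
        (2 * ((b $ I k \<omega> - X k \<omega> \<bullet> row (I k \<omega>) A) / (norm (row (I k \<omega>) A))\<^sup>2))
          *\<^sub>R row (I k \<omega>) A"
    and "m \<ge> 1"
  shows "prob_space.expectation M (\<lambda>\<omega>. norm (x - (1 / real m) *\<^sub>R (\<Sum>k=1..m. X k \<omega>)))
    \<le> (1 + frobenius_norm A * matrix_opnorm (matrix_inv A)) / sqrt (real m) * norm (x - x1)"
proof -
  interpret prob_space M by fact
  let ?Y = "\<lambda>n \<omega>. reflect_path (\<lambda>i. row i A) (x - x1) (\<lambda>k. I k \<omega>) n"
  define \<kappa> where "\<kappa> = frobenius_norm A * matrix_opnorm (matrix_inv A)"
  have error: "x - X (Suc n) \<omega> = ?Y n \<omega>" if \<omega>: "\<omega> \<in> space M" for n \<omega>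
  proof (induction n)
    case 0
    show ?case using assms(6)[OF \<omega>] by simp
  next
    case (Suc n)
    let ?a = "row (I (Suc n) \<omega>) A"
    have "b $ I (Suc n) \<omega> = ?a \<bullet> x"
      using assms(2) mult_vec_nth_row by metis
    then have "b $ I (Suc n) \<omega> - X (Suc n) \<omega> \<bullet> ?a = ?a \<bullet> (x - X (Suc n) \<omega>)"
      by (simp add: inner_diff_right inner_commute)
    then have "x - X (Suc (Suc n)) \<omega> = reflect ?a (x - X (Suc n) \<omega>)"
      using assms(7)[OF _ \<omega>, of "Suc n"] by (simp add: reflect_def)
    then show ?case by (simp add: Suc.IH)
  qed
  have average: "norm (x - (1 / real m) *\<^sub>R (\<Sum>k=1..m. X k \<omega>)) = norm (\<Sum>n<m. ?Y n \<omega>) / m"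
    if \<omega>: "\<omega> \<in> space M" for \<omega>
  proof -
    have "(\<Sum>n<m. ?Y n \<omega>) = (\<Sum>k=1..m. x - X k \<omega>)"
      unfolding error[OF \<omega>, symmetric]
      by (rule sum.reindex_bij_witness[of _ "\<lambda>k. k - 1" Suc]) auto
    also have "\<dots> = m *\<^sub>R (x - (1 / real m) *\<^sub>R (\<Sum>k=1..m. X k \<omega>))"
      using assms(8)
      by (simp add: sum_subtractf scaleR_diff_right sum_constant_scaleR del: sum_constant)
    finally show ?thesis using assms(8) by simp
  qed
  have "expectation (\<lambda>\<omega>. norm (x - (1 / real m) *\<^sub>R (\<Sum>k=1..m. X k \<omega>)))
      = expectation (\<lambda>\<omega>. norm (\<Sum>n<m. ?Y n \<omega>)) / m"
    using Bochner_Integration.integral_cong[OF refl average] by simp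
  also have "\<dots> \<le> (1 + \<kappa>) * sqrt m * norm (x - x1) / m"
    by (intro divide_right_mono expectation_norm_sum_reflect_path_le assms(1,4,5) \<kappa>_def) auto
  also have "\<dots> = (1 + \<kappa>) / sqrt m * norm (x - x1)"
    using real_div_sqrt[of "real m"] by (simp add: divide_simps)
  finally show ?thesis by (simp add: \<kappa>_def)
qed

end
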